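(* Let $t\le1$, and in cylindrical coordinates $(\rho,\theta,z)$ consider on the cylinder $\{0\le\rho\le1\}\subset\mathbb R^3$ the "escape into third dimension" director $$\mathbf n(\rho,\theta,z)=\cos\Psi(\rho)\,\mathbf e_r+\sin\Psi(\rho)\,\mathbf e_z,\qquad \rho\,\frac{\mathrm d\Psi}{\mathrm d\rho}=\cos\Psi,$$ where $\mathbf e_r=(\cos\theta,\sin\theta,0)$, $\mathbf e_z=(0,0,1)$, and $\cos\Psi\not\equiv0$. Then there is no scalar function $s=s(\rho,\theta,z)$, not identically zero, such that the pair $(s,\mathbf n)$ satisfies $$\begin{cases}\Delta s = 3|\nabla\mathbf n|^2 s + ts-\sqrt6\,s^2+\frac43s^3,\\[2pt] s\,\Delta\mathbf n+2(\nabla s\cdot\nabla)\mathbf n+s|\nabla\mathbf n|^2\mathbf n=0.\end{cases}$$ In particular, this director cannot be the director of a uniaxial solution $\mathbf Q=s(\mathbf n\otimes\mathbf n-\frac13\mathbf I)$, with $s\not\equiv0$, of $$\Delta \mathbf{Q}_{ij} = t\,\mathbf{Q}_{ij} - 3\sqrt6\Bigl(\mathbf{Q}_{ik}\mathbf{Q}_{kj}-\tfrac13\delta_{ij}\,\mathrm{tr}(\mathbf{Q}^2)\Bigr)+2\,\mathbf{Q}_{ij}\,\mathrm{tr}(\mathbf{Q}^2),\qquad i,j=1,2,3.$$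
   Context: Here $\mathbf x=(\rho\cos\theta,\rho\sin\theta,z)$, $|\nabla\mathbf n|^2=\sum_{i,j}(\partial_jn_i)^2$, $(\nabla s\cdot\nabla)\mathbf n=\sum_k\partial_ks\,\partial_k\mathbf n$, $\mathbf I$ is the $3\times3$ identity, repeated indices are summed, and solutions are classical. No assumption is made on the dependence of $s$ on $z$. The real number $t$ is the reduced temperature. *)

theory Defs
  imports "HOL-Analysis.Analysis"
begin

definition partial :: "3 \<Rightarrow> (real^3 \<Rightarrow> 'a::real_normed_vector) \<Rightarrow> real^3 \<Rightarrow> 'a"
  where "partial k f x = frechet_derivative f (at x) (axis k 1)"

definition laplacian :: "(real^3 \<Rightarrow> 'a::real_normed_vector) \<Rightarrow> real^3 \<Rightarrow> 'a"
  where "laplacian f x = (\<Sum>k\<in>UNIV. partial k (partial k f) x)"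

definition C1_on :: "(real^3) set \<Rightarrow> (real^3 \<Rightarrow> 'a::real_normed_vector) \<Rightarrow> bool"
  where "C1_on U f \<longleftrightarrow>
    (\<forall>x\<in>U. f differentiable (at x)) \<and> (\<forall>k. continuous_on U (partial k f))"

definition C2_on :: "(real^3) set \<Rightarrow> (real^3 \<Rightarrow> 'a::real_normed_vector) \<Rightarrow> bool"
  where "C2_on U f \<longleftrightarrow> C1_on U f \<and> (\<forall>k. C1_on U (partial k f))"

text \<open>Regularity of a classical solution on a set with boundary: continuous on the whole set,
  twice continuously differentiable in its interior (where the equations are imposed).
  Functions that are twice continuously differentiable up to the boundary are included.\<close>

definition classical_on :: "(real^3) set \<Rightarrow> (real^3 \<Rightarrow> 'a::real_normed_vector) \<Rightarrow> bool"
  where "classical_on S f \<longleftrightarrow> continuous_on S f \<and> C2_on (interior S) f"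

definition cyl_coords :: "real \<Rightarrow> real \<Rightarrow> real \<Rightarrow> real^3"
  where "cyl_coords \<rho> \<theta> z = vector [\<rho> * cos \<theta>, \<rho> * sin \<theta>, z]"

definition cylinder :: "(real^3) set"
  where "cylinder = {cyl_coords \<rho> \<theta> z | \<rho> \<theta> z. 0 \<le> \<rho> \<and> \<rho> \<le> 1}"

definition e_r :: "real \<Rightarrow> real^3"
  where "e_r \<theta> = vector [cos \<theta>, sin \<theta>, 0]"

definition e_z :: "real^3"
  where "e_z = vector [0, 0, 1]"

text \<open>The derivative is one-sided at the end points; at \<open>\<rho> = 0\<close> the equation says
  \<open>cos (\<Psi> 0) = 0\<close>.\<close>

definition escape_angle :: "(real \<Rightarrow> real) \<Rightarrow> bool"
  where "escape_angle \<Psi> \<longleftrightarrow>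
    (\<forall>\<rho>\<in>{0..1}. \<exists>D. (\<Psi> has_real_derivative D) (at \<rho> within {0..1}) \<and> \<rho> * D = cos (\<Psi> \<rho>))"

text \<open>Since \<open>cos (\<Psi> 0) = 0\<close> for an escape angle, the requirement is consistent on the axis
  \<open>\<rho> = 0\<close>, where \<open>\<theta>\<close> is undetermined. Values of the director outside the cylinder are
  unconstrained and never used.\<close>

definition escape_director :: "(real \<Rightarrow> real) \<Rightarrow> (real^3 \<Rightarrow> real^3) \<Rightarrow> bool"
  where "escape_director \<Psi> n \<longleftrightarrow>
    (\<forall>\<rho>\<in>{0..1}. \<forall>\<theta> z.
      n (cyl_coords \<rho> \<theta> z) = cos (\<Psi> \<rho>) *\<^sub>R e_r \<theta> + sin (\<Psi> \<rho>) *\<^sub>R e_z)"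

definition grad_norm_sq :: "(real^3 \<Rightarrow> real^3) \<Rightarrow> real^3 \<Rightarrow> real"
  where "grad_norm_sq n x = (\<Sum>i\<in>UNIV. \<Sum>j\<in>UNIV. (partial j (\<lambda>y. n y $ i) x)\<^sup>2)"

definition uniaxial_system ::
    "real \<Rightarrow> (real^3 \<Rightarrow> real) \<Rightarrow> (real^3 \<Rightarrow> real^3) \<Rightarrow> real^3 \<Rightarrow> bool"
  where "uniaxial_system t s n x \<longleftrightarrow>
    laplacian s x
      = 3 * grad_norm_sq n x * s x + t * s x - sqrt 6 * (s x)\<^sup>2 + 4 / 3 * (s x)^3 \<and>
    s x *\<^sub>R laplacian n x + 2 *\<^sub>R (\<Sum>k\<in>UNIV. partial k s x *\<^sub>R partial k n x)
      + (s x * grad_norm_sq n x) *\<^sub>R n x = 0"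

definition uniaxial_tensor :: "real \<Rightarrow> real^3 \<Rightarrow> real^3^3"
  where "uniaxial_tensor s n = s *\<^sub>R ((\<chi> i j. n $ i * n $ j) - (1 / 3) *\<^sub>R mat 1)"

definition Q_equation :: "real \<Rightarrow> (real^3 \<Rightarrow> real^3^3) \<Rightarrow> real^3 \<Rightarrow> bool"
  where "Q_equation t Q x \<longleftrightarrow> (\<forall>i j.
    laplacian (\<lambda>y. Q y $ i $ j) x
      = t * Q x $ i $ j
        - 3 * sqrt 6 * ((\<Sum>k\<in>UNIV. Q x $ i $ k * Q x $ k $ j)
            - 1 / 3 * (if i = j then 1 else 0) * trace (Q x ** Q x))
        + 2 * Q x $ i $ j * trace (Q x ** Q x))"

end

theory Submission
  imports Defs
begin

text \<open>The escape director is rigid because it is, up to the choice of one real parameter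
  \<open>a \<noteq> 0\<close>, the inverse stereographic projection of the scaled plane point
  \<open>(a x\<^sub>1, a x\<^sub>2)\<close>, which is a conformal harmonic map into the sphere. The parameter comes
  from the first integral \<open>cos \<Psi> / ((1 - sin \<Psi>) \<rho>)\<close> of the angle equation
  (lemma \<open>escape_angle_explicit\<close>).

  Harmonicity, \<open>\<Delta>n = - |\<nabla>n|\<^sup>2 n\<close>, cancels the zeroth order terms of the vector equation
  and leaves \<open>(\<nabla>s \<cdot> \<nabla>)n = 0\<close>. The two horizontal derivatives of \<open>n\<close> are linearly
  independent, so \<open>s\<close> has no horizontal derivatives: along each horizontal ray it depends on the
  height alone, and so do \<open>\<Delta>s\<close> and every term of the scalar equation except
  \<open>3 |\<nabla>n|\<^sup>2 s\<close>. But \<open>|\<nabla>n|\<^sup>2 = 8 a\<^sup>2 / (1 + a\<^sup>2 \<rho>\<^sup>2)\<^sup>2\<close> takes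
  different values at different radii; comparing the equation at two radii on one ray gives
  \<open>s = 0\<close> (lemma \<open>vanishing_of_inv_stereo_system\<close>). All this is done off the axis and inside the
  lateral boundary; continuity along rays extends the conclusion to the whole cylinder.

  For the tensor equation, contracting with \<open>n\<close> once and twice and using \<open>|n| = 1\<close> separates
  the component along \<open>n\<close> from the orthogonal ones, which turns it into the scalar-vector system
  (lemma \<open>uniaxial_system_if_Q_equation\<close>). The order parameter inherits the required regularity from
  \<open>Q\<close> because \<open>s = 3/2 n \<cdot> Q n\<close>.\<close>

section \<open>Calculus of partial derivatives\<close>

lemma partial_eq:
  assumes "(f has_derivative F) (at x)"
  shows "partial k f x = F (axis k 1)"
  using frechet_derivative_at[OF assms] by (simp add: partial_def)

lemma partial_cong_open:
  assumes "open U" "\<And>y. y \<in> U \<Longrightarrow> f y = g y" "x \<in> U"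
  shows "partial k f x = partial k g x"
proof -
  have "(f has_derivative F) (at x) \<longleftrightarrow> (g has_derivative F) (at x)" for F
    using assms has_derivative_transform_within_open[of f F x UNIV U g]
      has_derivative_transform_within_open[of g F x UNIV U f] by auto
  then show ?thesis by (simp add: partial_def frechet_derivative_def)
qed

lemma differentiable_cong_open:
  assumes "open U" "\<And>y. y \<in> U \<Longrightarrow> f y = g y" "x \<in> U" "f differentiable (at x)"
  shows "g differentiable (at x)"
  using assms has_derivative_transform_within_open[of f _ x UNIV U g]
  unfolding differentiable_def by blast

lemma partial_const [simp]: "partial k (\<lambda>y. c) = (\<lambda>y. 0)"
  by (rule ext) (rule partial_eq[OF has_derivative_const])

lemma partial_component_id: "partial k (\<lambda>y. y $ i) = (\<lambda>y. if i = k then 1 else 0)"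
proof
  fix x
  have "((\<lambda>y. y $ i) has_derivative (\<lambda>h::real^3. h $ i)) (at x)"
    by (intro bounded_linear_imp_has_derivative bounded_linear_vec_nth)
  from partial_eq[OF this] show "partial k (\<lambda>y. y $ i) x = (if i = k then 1 else 0)"
    by (simp add: axis_def)
qed

lemma partial_linear:
  assumes "bounded_linear L" "f differentiable (at x)"
  shows "partial k (\<lambda>y. L (f y)) x = L (partial k f x)"
proof -
  have "(f has_derivative frechet_derivative f (at x)) (at x)"
    using assms(2) frechet_derivative_works by blast
  from partial_eq[OF bounded_linear.has_derivative[OF assms(1) this]]
  show ?thesis by (simp add: partial_def)
qed

lemma partial_add:
  assumes "f differentiable (at x)" "g differentiable (at x)"
  shows "partial k (\<lambda>y. f y + g y) x = partial k f x + partial k g x"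
  using partial_eq[OF has_derivative_add[OF assms[unfolded frechet_derivative_works]]]
  by (simp add: partial_def)

lemma partial_diff:
  assumes "f differentiable (at x)" "g differentiable (at x)"
  shows "partial k (\<lambda>y. f y - g y) x = partial k f x - partial k g x"
  using partial_eq[OF has_derivative_diff[OF assms[unfolded frechet_derivative_works]]]
  by (simp add: partial_def)

lemma partial_minus:
  assumes "f differentiable (at x)"
  shows "partial k (\<lambda>y. - f y) x = - partial k f x"
  using partial_linear[OF bounded_linear_minus[OF bounded_linear_ident] assms] .

lemma partial_mult:
  fixes f g :: "real^3 \<Rightarrow> real"
  assumes "f differentiable (at x)" "g differentiable (at x)"
  shows "partial k (\<lambda>y. f y * g y) x = partial k f x * g x + f x * partial k g x"
  using partial_eq[OF has_derivative_mult[OF assms[unfolded frechet_derivative_works]]]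
  by (simp add: partial_def)

lemma partial_inverse:
  fixes f :: "real^3 \<Rightarrow> real"
  assumes "f differentiable (at x)" "f x \<noteq> 0"
  shows "partial k (\<lambda>y. inverse (f y)) x = - (partial k f x * (inverse (f x))\<^sup>2)"
  using partial_eq[OF Deriv.has_derivative_inverse[OF assms(2) assms(1)[unfolded frechet_derivative_works]]]
  by (simp add: partial_def power2_eq_square)

text \<open>Pointwise second order differentiability: closure under products and linear maps, and the
  product rule for the Laplacian, then follow from the differentiation rules alone.\<close>

definition twice_diff_on :: "(real^3) set \<Rightarrow> (real^3 \<Rightarrow> 'a::real_normed_vector) \<Rightarrow> bool"
  where "twice_diff_on U f \<longleftrightarrow> (\<forall>x\<in>U. f differentiable (at x)) \<and>
    (\<forall>k. \<forall>x\<in>U. partial k f differentiable (at x))"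

lemma twice_diff_onD:
  assumes "twice_diff_on U f" "x \<in> U"
  shows "f differentiable (at x)" "partial k f differentiable (at x)"
  using assms by (auto simp: twice_diff_on_def)

lemma classical_on_imp_twice_diff_on:
  "classical_on S f \<Longrightarrow> U \<subseteq> interior S \<Longrightarrow> twice_diff_on U f"
  by (auto simp: classical_on_def C2_on_def C1_on_def twice_diff_on_def)

lemma twice_diff_on_cong:
  assumes "open U" "\<And>y. y \<in> U \<Longrightarrow> f y = g y" "twice_diff_on U f"
  shows "twice_diff_on U g"
  unfolding twice_diff_on_def
proof (intro conjI ballI allI)
  fix x assume x: "x \<in> U"
  show "g differentiable (at x)"
    using differentiable_cong_open[where f=f and g=g, OF assms(1,2) x]
      twice_diff_onD(1)[OF assms(3) x] by blast
  show "partial k g differentiable (at x)" for k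
    using differentiable_cong_open[where f="partial k f" and g="partial k g",
        OF assms(1) partial_cong_open[OF assms(1,2)] x] twice_diff_onD(2)[OF assms(3) x] by blast
qed

lemma laplacian_cong_open:
  assumes "open U" "\<And>y. y \<in> U \<Longrightarrow> f y = g y" "x \<in> U"
  shows "laplacian f x = laplacian g x"
  unfolding laplacian_def
  by (intro sum.cong refl partial_cong_open[OF assms(1) _ assms(3)])
     (rule partial_cong_open[OF assms(1,2)])

lemma laplacian_const [simp]: "laplacian (\<lambda>y. c) x = 0"
  by (simp add: laplacian_def)

lemma twice_diff_on_const: "twice_diff_on U (\<lambda>y. c)"
  by (simp add: twice_diff_on_def)

lemma twice_diff_on_component_id: "twice_diff_on U (\<lambda>y. y $ i)"
  by (simp add: twice_diff_on_def partial_component_id bounded_linear_imp_differentiable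
      bounded_linear_vec_nth)

lemma twice_diff_on_linear:
  assumes "open U" "bounded_linear L" "twice_diff_on U f"
  shows "twice_diff_on U (\<lambda>y. L (f y))"
    and "x \<in> U \<Longrightarrow> laplacian (\<lambda>y. L (f y)) x = L (laplacian f x)"
proof -
  have p: "partial k (\<lambda>y. L (f y)) y = L (partial k f y)" if "y \<in> U" for k y
    using partial_linear[OF assms(2)] twice_diff_onD[OF assms(3) that] by blast
  have d: "(\<lambda>y. L (g y)) differentiable (at y)" if "g differentiable (at y)"
    for y :: "real^3" and g
    using that bounded_linear.has_derivative[OF assms(2)] unfolding differentiable_def by blast
  show "twice_diff_on U (\<lambda>y. L (f y))"
    unfolding twice_diff_on_def
  proof (intro conjI ballI allI)
    fix x assume x: "x \<in> U"
    show "(\<lambda>y. L (f y)) differentiable (at x)"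
      using d twice_diff_onD[OF assms(3) x] by blast
    show "partial k (\<lambda>y. L (f y)) differentiable (at x)" for k
      by (rule differentiable_cong_open[OF assms(1) p[symmetric] x])
         (use d twice_diff_onD[OF assms(3) x] in blast)+
  qed
  assume x: "x \<in> U"
  have "partial k (partial k (\<lambda>y. L (f y))) x = L (partial k (partial k f) x)" for k
    using partial_cong_open[OF assms(1) p x, where k=k]
      partial_linear[OF assms(2) twice_diff_onD(2)[OF assms(3) x]] by simp
  then show "laplacian (\<lambda>y. L (f y)) x = L (laplacian f x)"
    by (simp add: laplacian_def linear_sum[OF bounded_linear.linear[OF assms(2)]])
qed

lemma twice_diff_on_add:
  assumes "open U" "twice_diff_on U f" "twice_diff_on U g"
  shows "twice_diff_on U (\<lambda>y. f y + g y)"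
    and "x \<in> U \<Longrightarrow> laplacian (\<lambda>y. f y + g y) x = laplacian f x + laplacian g x"
proof -
  have p: "partial k (\<lambda>y. f y + g y) y = partial k f y + partial k g y" if "y \<in> U" for k y
    using partial_add twice_diff_onD assms(2,3) that by blast
  show "twice_diff_on U (\<lambda>y. f y + g y)"
    unfolding twice_diff_on_def
  proof (intro conjI ballI allI)
    fix x assume x: "x \<in> U"
    note D = twice_diff_onD[OF assms(2) x] twice_diff_onD[OF assms(3) x]
    show "(\<lambda>y. f y + g y) differentiable (at x)"
      using D by (intro differentiable_add)
    show "partial k (\<lambda>y. f y + g y) differentiable (at x)" for k
      by (rule differentiable_cong_open[OF assms(1) p[symmetric] x])
         (use D in \<open>auto intro!: differentiable_add\<close>)
  qed
  assume x: "x \<in> U"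
  have "partial k (partial k (\<lambda>y. f y + g y)) x = partial k (partial k f) x + partial k (partial k g) x"
    for k
    using partial_cong_open[OF assms(1) p x, where k=k]
      partial_add[OF twice_diff_onD(2)[OF assms(2) x] twice_diff_onD(2)[OF assms(3) x]] by simp
  then show "laplacian (\<lambda>y. f y + g y) x = laplacian f x + laplacian g x"
    by (simp add: laplacian_def sum.distrib)
qed

lemma twice_diff_on_diff:
  assumes "open U" "twice_diff_on U f" "twice_diff_on U g"
  shows "twice_diff_on U (\<lambda>y. f y - g y)"
    and "x \<in> U \<Longrightarrow> laplacian (\<lambda>y. f y - g y) x = laplacian f x - laplacian g x"
proof -
  note m = twice_diff_on_linear[OF assms(1) bounded_linear_minus[OF bounded_linear_ident] assms(3)]
  show "twice_diff_on U (\<lambda>y. f y - g y)"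
    using twice_diff_on_add(1)[OF assms(1,2) m(1)] by simp
  show "laplacian (\<lambda>y. f y - g y) x = laplacian f x - laplacian g x" if "x \<in> U"
    using twice_diff_on_add(2)[OF assms(1,2) m(1) that] m(2)[OF that] by simp
qed

lemma twice_diff_on_mult:
  fixes f g :: "real^3 \<Rightarrow> real"
  assumes "open U" "twice_diff_on U f" "twice_diff_on U g"
  shows "twice_diff_on U (\<lambda>y. f y * g y)"
    and "x \<in> U \<Longrightarrow> laplacian (\<lambda>y. f y * g y) x =
      laplacian f x * g x + 2 * (\<Sum>k\<in>UNIV. partial k f x * partial k g x) + f x * laplacian g x"
proof -
  have p: "partial k (\<lambda>y. f y * g y) y = partial k f y * g y + f y * partial k g y"
    if "y \<in> U" for k y
    using partial_mult twice_diff_onD assms(2,3) that by blast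
  show "twice_diff_on U (\<lambda>y. f y * g y)"
    unfolding twice_diff_on_def
  proof (intro conjI ballI allI)
    fix x assume x: "x \<in> U"
    note D = twice_diff_onD[OF assms(2) x] twice_diff_onD[OF assms(3) x]
    show "(\<lambda>y. f y * g y) differentiable (at x)"
      using D by (intro differentiable_mult)
    show "partial k (\<lambda>y. f y * g y) differentiable (at x)" for k
      by (rule differentiable_cong_open[OF assms(1) p[symmetric] x])
         (use D in \<open>auto intro!: differentiable_add differentiable_mult\<close>)
  qed
  assume x: "x \<in> U"
  note D = twice_diff_onD[OF assms(2) x] twice_diff_onD[OF assms(3) x]
  have "partial k (partial k (\<lambda>y. f y * g y)) x =
      partial k (partial k f) x * g x + 2 * (partial k f x * partial k g x)
      + f x * partial k (partial k g) x" for k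
    using partial_cong_open[OF assms(1) p x, where k=k] D
    by (simp add: partial_add partial_mult differentiable_mult)
  then show "laplacian (\<lambda>y. f y * g y) x =
      laplacian f x * g x + 2 * (\<Sum>k\<in>UNIV. partial k f x * partial k g x) + f x * laplacian g x"
    by (simp add: laplacian_def sum.distrib sum_distrib_left sum_distrib_right)
qed

lemma twice_diff_on_sum3:
  fixes f :: "3 \<Rightarrow> real^3 \<Rightarrow> 'a::real_normed_vector"
  assumes "open U" "\<And>i. twice_diff_on U (f i)"
  shows "twice_diff_on U (\<lambda>y. \<Sum>i\<in>UNIV. f i y)"
    and "x \<in> U \<Longrightarrow> laplacian (\<lambda>y. \<Sum>i\<in>UNIV. f i y) x = (\<Sum>i\<in>UNIV. laplacian (f i) x)"
  using assms by (simp_all add: sum_3 twice_diff_on_add)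

lemma partial_vec_nth:
  assumes "f differentiable (at x)"
  shows "partial k (\<lambda>y. f y $ i) x = partial k f x $ i"
  using partial_linear[OF bounded_linear_vec_nth assms] .

lemma twice_diff_on_vec_nth:
  assumes "open U" "twice_diff_on U f"
  shows "twice_diff_on U (\<lambda>y. f y $ i)"
    and "x \<in> U \<Longrightarrow> laplacian (\<lambda>y. f y $ i) x = laplacian f x $ i"
  using twice_diff_on_linear[OF assms(1) bounded_linear_vec_nth assms(2)] by blast+

lemma twice_diff_on_vecI:
  fixes f :: "real^3 \<Rightarrow> real^3"
  assumes "open U" "\<And>i. twice_diff_on U (\<lambda>y. f y $ i)"
  shows "twice_diff_on U f"
proof -
  have "twice_diff_on U (\<lambda>y. \<Sum>i\<in>UNIV. f y $ i *\<^sub>R (axis i 1 :: real^3))"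
    using assms
    by (intro twice_diff_on_sum3(1) twice_diff_on_linear(1)[OF _ bounded_linear_scaleR_left])
  then show ?thesis
    using basis_expansion[of "f y" for y] by (simp add: scalar_mult_eq_scaleR)
qed

section \<open>The uniaxial system and the tensor equation\<close>

lemma uniaxial_system_cong_open:
  assumes "open U" "\<And>y. y \<in> U \<Longrightarrow> n y = m y" "x \<in> U"
  shows "uniaxial_system t s n x \<longleftrightarrow> uniaxial_system t s m x"
proof -
  have "grad_norm_sq n x = grad_norm_sq m x"
    unfolding grad_norm_sq_def using assms
    by (intro sum.cong refl arg_cong[where f="\<lambda>r. r\<^sup>2"] partial_cong_open[OF assms(1)]) auto
  then show ?thesis
    using laplacian_cong_open[OF assms] partial_cong_open[OF assms] assms(2,3)
    by (simp add: uniaxial_system_def)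
qed

text \<open>Both identities come from differentiating \<open>|n|\<^sup>2 = 1\<close>, once with \<open>\<partial>\<^sub>k\<close> and once with
  the Laplacian.\<close>

lemma inner_laplacian_unit_field:
  fixes n :: "real^3 \<Rightarrow> real^3"
  assumes "open U" "twice_diff_on U n" "\<And>y. y \<in> U \<Longrightarrow> (\<Sum>i\<in>UNIV. (n y $ i)\<^sup>2) = 1" "x \<in> U"
  shows "(\<Sum>i\<in>UNIV. n x $ i * partial k (\<lambda>y. n y $ i) x) = 0"
    and "(\<Sum>i\<in>UNIV. n x $ i * laplacian (\<lambda>y. n y $ i) x) = - grad_norm_sq n x"
proof -
  note td = twice_diff_on_vec_nth(1)[OF assms(1,2)]
  note D = twice_diff_onD[OF td assms(4)]
  have "partial k (\<lambda>y. \<Sum>i\<in>UNIV. n y $ i * n y $ i) x = partial k (\<lambda>y. 1::real) x"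
    by (rule partial_cong_open[OF assms(1) _ assms(4)]) (use assms(3) in \<open>simp add: power2_eq_square\<close>)
  then show "(\<Sum>i\<in>UNIV. n x $ i * partial k (\<lambda>y. n y $ i) x) = 0"
    using D by (simp add: sum_3 partial_add partial_mult)
  have "laplacian (\<lambda>y. \<Sum>i\<in>UNIV. n y $ i * n y $ i) x = laplacian (\<lambda>y. 1::real) x"
    by (rule laplacian_cong_open[OF assms(1) _ assms(4)]) (use assms(3) in \<open>simp add: power2_eq_square\<close>)
  then have "(\<Sum>i\<in>UNIV. laplacian (\<lambda>y. n y $ i * n y $ i) x) = 0"
    using twice_diff_on_sum3(2)[OF assms(1) twice_diff_on_mult(1)[OF assms(1) td td] assms(4)] by simp
  then show "(\<Sum>i\<in>UNIV. n x $ i * laplacian (\<lambda>y. n y $ i) x) = - grad_norm_sq n x"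
    by (simp add: twice_diff_on_mult(2)[OF assms(1) td td assms(4)] grad_norm_sq_def sum_3
        power2_eq_square)
qed

lemma uniaxial_tensor_nth:
  "uniaxial_tensor s n $ i $ j = s * (n $ i * n $ j - (if i = j then 1/3 else 0))"
  by (simp add: uniaxial_tensor_def mat_def)

text \<open>Recovers \<open>s\<close> from \<open>Q\<close> linearly, hence without loss of regularity or division by
  entries of \<open>Q\<close> that may vanish.\<close>

lemma uniaxial_tensor_contract:
  assumes "(\<Sum>i\<in>UNIV. (n $ i)\<^sup>2) = 1"
  shows "(\<Sum>i\<in>UNIV. \<Sum>j\<in>UNIV. n $ i * (uniaxial_tensor s n $ i $ j * n $ j)) = 2/3 * s"
proof -
  have "(n $ 1)\<^sup>2 = 1 - (n $ 2)\<^sup>2 - (n $ 3)\<^sup>2" using assms by (simp add: sum_3)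
  then show ?thesis
    unfolding uniaxial_tensor_nth sum_3 by simp algebra
qed

text \<open>For a uniaxial tensor the traceless part of the square is again a multiple of the tensor, so the
  right-hand side of the tensor equation points along \<open>n \<otimes> n - I/3\<close>.\<close>

lemma uniaxial_tensor_square:
  assumes "(\<Sum>i\<in>UNIV. (n $ i)\<^sup>2) = 1" and Q: "Q = uniaxial_tensor s n"
  shows "trace (Q ** Q) = 2/3 * s\<^sup>2"
    and "(\<Sum>k\<in>UNIV. Q $ i $ k * Q $ k $ j) - 1/3 * (if i = j then 1 else 0) * trace (Q ** Q)
      = s\<^sup>2 / 3 * (n $ i * n $ j - (if i = j then 1/3 else 0))"
proof -
  have n: "(\<Sum>k\<in>UNIV. n $ k * n $ k) = 1" using assms(1) by (simp add: power2_eq_square)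
  have sq: "(\<Sum>k\<in>UNIV. Q $ i $ k * Q $ k $ j) =
     s\<^sup>2 * (n $ i * n $ j / 3 + (if i = j then 1/9 else 0))" for i j
  proof -
    have "(\<Sum>k\<in>UNIV. Q $ i $ k * Q $ k $ j) = (\<Sum>k\<in>UNIV. s\<^sup>2 * (n $ i * n $ j * (n $ k * n $ k)
        - (if i = k then 1/3 * (n $ k * n $ j) else 0) - (if k = j then 1/3 * (n $ i * n $ k) else 0)
        + (if i = k then (if k = j then 1/9 else 0) else 0)))"
      by (intro sum.cong refl) (auto simp: Q uniaxial_tensor_nth algebra_simps power2_eq_square)
    also have "\<dots> = s\<^sup>2 * (n $ i * n $ j * (\<Sum>k\<in>UNIV. n $ k * n $ k)
        - 1/3 * (n $ i * n $ j) - 1/3 * (n $ i * n $ j) + (if i = j then 1/9 else 0))"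
      by (simp add: sum_distrib_left[symmetric] sum.distrib sum_subtractf)
    finally show ?thesis by (simp add: n algebra_simps)
  qed
  have "trace (Q ** Q) = (\<Sum>i\<in>UNIV. s\<^sup>2 * (n $ i * n $ i / 3 + 1/9))"
    using sq by (simp add: trace_def matrix_matrix_mult_def)
  also have "\<dots> = s\<^sup>2 * ((\<Sum>i\<in>UNIV. n $ i * n $ i) / 3 + 3 * (1/9))"
    unfolding sum_3 by (simp add: algebra_simps)
  finally show tr: "trace (Q ** Q) = 2/3 * s\<^sup>2" by (simp add: n)
  show "(\<Sum>k\<in>UNIV. Q $ i $ k * Q $ k $ j) - 1/3 * (if i = j then 1 else 0) * trace (Q ** Q)
      = s\<^sup>2 / 3 * (n $ i * n $ j - (if i = j then 1/3 else 0))"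
    unfolding sq tr by (simp add: field_simps)
qed

text \<open>By the product rule every entry of the equation is an identity between second order expressions
  in \<open>s\<close> and \<open>n\<close>. Contracting one index with \<open>n\<close> removes the terms
  \<open>n \<cdot> \<partial>\<^sub>k n = 0\<close> and turns \<open>n \<cdot> \<Delta>n\<close> into \<open>- |\<nabla>n|\<^sup>2\<close>. A second contraction yields the scalar
  equation, and substituting it back into the first yields the vector equation.\<close>

lemma uniaxial_system_if_Q_equation:
  assumes U: "open U" and x: "x \<in> U" and s: "twice_diff_on U s" and n: "twice_diff_on U n"
    and unit: "\<And>y. y \<in> U \<Longrightarrow> (\<Sum>i\<in>UNIV. (n y $ i)\<^sup>2) = 1"
    and Q: "\<And>y. y \<in> U \<Longrightarrow> Q y = uniaxial_tensor (s y) (n y)"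
    and eq: "Q_equation t Q x"
  shows "uniaxial_system t s n x"
proof -
  define p where "p k i = partial k (\<lambda>y. n y $ i) x" for k i
  define l where "l i = laplacian (\<lambda>y. n y $ i) x" for i
  define m where "m i = n x $ i" for i
  define ds where "ds k = partial k s x" for k
  define G where "G = grad_norm_sq n x"
  define f where "f = t * s x - sqrt 6 * (s x)\<^sup>2 + 4/3 * (s x)^3"
  note td = twice_diff_on_vec_nth(1)[OF U n]
  note D = twice_diff_onD[OF td x] twice_diff_onD[OF s x]
  have m1: "(\<Sum>j\<in>UNIV. m j * m j) = 1" using unit[OF x] by (simp add: m_def power2_eq_square)
  have mp: "(\<Sum>j\<in>UNIV. m j * p k j) = 0" for k
    using inner_laplacian_unit_field(1)[OF U n unit x] by (simp add: m_def p_def)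
  have ml: "(\<Sum>j\<in>UNIV. m j * l j) = - G"
    using inner_laplacian_unit_field(2)[OF U n unit x] by (simp add: m_def l_def G_def)
  define P where "P i j y = n y $ i * n y $ j - (if i = j then 1/3 else 0)" for i j y
  have tdP: "twice_diff_on U (P i j)" for i j
    unfolding P_def by (intro twice_diff_on_diff(1) twice_diff_on_mult(1) twice_diff_on_const td U)
  have pP: "partial k (P i j) x = p k i * m j + m i * p k j" for i j k
    unfolding P_def using D
    by (simp only: partial_diff partial_mult differentiable_mult differentiable_const partial_const p_def m_def
        diff_zero)
  have lP: "laplacian (P i j) x = l i * m j + 2 * (\<Sum>k\<in>UNIV. p k i * p k j) + m i * l j" for i j
    unfolding P_def
    by (subst twice_diff_on_diff(2)[OF U twice_diff_on_mult(1)[OF U td td] twice_diff_on_const x])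
       (simp add: twice_diff_on_mult(2)[OF U td td x] p_def m_def l_def)
  \<comment> \<open>Entry \<open>(i, j)\<close> of the tensor equation, with both sides expanded.\<close>
  have main: "laplacian s x * P i j x
      + 2 * (\<Sum>k\<in>UNIV. ds k * (p k i * m j + m i * p k j))
      + s x * (l i * m j + 2 * (\<Sum>k\<in>UNIV. p k i * p k j) + m i * l j) = f * P i j x" for i j
  proof -
    have "laplacian (\<lambda>y. Q y $ i $ j) x = laplacian (\<lambda>y. s y * P i j y) x"
      by (rule laplacian_cong_open[OF U _ x]) (simp add: Q uniaxial_tensor_nth P_def)
    also have "\<dots> = laplacian s x * P i j x
      + 2 * (\<Sum>k\<in>UNIV. ds k * (p k i * m j + m i * p k j))
      + s x * (l i * m j + 2 * (\<Sum>k\<in>UNIV. p k i * p k j) + m i * l j)"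
      by (simp add: twice_diff_on_mult(2)[OF U s tdP x] pP lP ds_def)
    finally have 1: "laplacian (\<lambda>y. Q y $ i $ j) x = \<dots>" .
    have "laplacian (\<lambda>y. Q y $ i $ j) x = t * Q x $ i $ j - 3 * sqrt 6 * ((s x)\<^sup>2 / 3 * P i j x)
        + 2 * Q x $ i $ j * (2/3 * (s x)\<^sup>2)"
      using eq unfolding Q_equation_def uniaxial_tensor_square(2)[OF unit[OF x] Q[OF x]]
      unfolding uniaxial_tensor_square(1)[OF unit[OF x] Q[OF x]] P_def by blast
    also have "\<dots> = f * P i j x"
      by (simp add: Q[OF x] uniaxial_tensor_nth P_def f_def algebra_simps power2_eq_square power3_eq_cube)
    finally show ?thesis using 1 by simp
  qed
  have Pm: "(\<Sum>j\<in>UNIV. P i j x * m j) = 2/3 * m i" for i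
  proof -
    have "(\<Sum>j\<in>UNIV. P i j x * m j) = (\<Sum>j\<in>UNIV. m i * (m j * m j) - (if i = j then 1/3 * m j else 0))"
      by (intro sum.cong refl) (simp add: P_def m_def algebra_simps)
    also have "\<dots> = m i * (\<Sum>j\<in>UNIV. m j * m j) - 1/3 * m i"
      by (simp add: sum_subtractf sum_distrib_left)
    finally show ?thesis using m1 by simp
  qed
  \<comment> \<open>Contraction of \<open>j\<close> with \<open>n\<close>; the normal part of the vector equation is still mixed in.\<close>
  have row: "laplacian s x * (2/3 * m i) + 2 * (\<Sum>k\<in>UNIV. ds k * p k i)
      + s x * (l i - G * m i) = f * (2/3 * m i)" for i
  proof -
    have "f * (\<Sum>j\<in>UNIV. P i j x * m j) = (\<Sum>j\<in>UNIV. (f * P i j x) * m j)"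
      by (simp add: sum_distrib_left mult.assoc)
    also have "\<dots> = laplacian s x * (\<Sum>j\<in>UNIV. P i j x * m j)
      + 2 * (\<Sum>k\<in>UNIV. ds k * (p k i * (\<Sum>j\<in>UNIV. m j * m j) + m i * (\<Sum>j\<in>UNIV. m j * p k j)))
      + s x * (l i * (\<Sum>j\<in>UNIV. m j * m j) + 2 * (\<Sum>k\<in>UNIV. p k i * (\<Sum>j\<in>UNIV. m j * p k j))
          + m i * (\<Sum>j\<in>UNIV. m j * l j))"
      unfolding main[symmetric] sum_3 by (simp add: algebra_simps)
    finally show ?thesis unfolding Pm m1 mp ml by (simp add: algebra_simps)
  qed
  have "(\<Sum>i\<in>UNIV. m i * (f * (2/3 * m i))) = f * (2/3 * (\<Sum>j\<in>UNIV. m j * m j))"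
    unfolding sum_3 by (simp add: algebra_simps)
  moreover have "(\<Sum>i\<in>UNIV. m i * (f * (2/3 * m i))) =
      laplacian s x * (2/3 * (\<Sum>j\<in>UNIV. m j * m j))
      + 2 * (\<Sum>k\<in>UNIV. ds k * (\<Sum>j\<in>UNIV. m j * p k j))
      + s x * ((\<Sum>j\<in>UNIV. m j * l j) - G * (\<Sum>j\<in>UNIV. m j * m j))"
    unfolding row[symmetric] sum_3 by (simp add: algebra_simps)
  ultimately have 1: "laplacian s x = f + 3 * G * s x"
    unfolding m1 mp ml by (simp add: algebra_simps)
  have 2: "s x * l i + 2 * (\<Sum>k\<in>UNIV. ds k * p k i) + s x * G * m i = 0" for i
    using row[of i] unfolding 1 by (simp add: field_simps)
  have comp: "partial k n x $ i = p k i" "laplacian n x $ i = l i" for k i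
    using partial_vec_nth[OF twice_diff_onD(1)[OF n x]] twice_diff_on_vec_nth(2)[OF U n x]
    by (simp_all add: p_def l_def)
  have "s x *\<^sub>R laplacian n x + 2 *\<^sub>R (\<Sum>k\<in>UNIV. partial k s x *\<^sub>R partial k n x)
      + (s x * grad_norm_sq n x) *\<^sub>R n x = 0"
    using 2 by (simp add: vec_eq_iff comp ds_def[symmetric] G_def[symmetric] m_def)
  then show ?thesis
    unfolding uniaxial_system_def using 1 by (simp add: f_def G_def)
qed

section \<open>The director is an inverse stereographic projection\<close>

text \<open>Half the conformal factor of the inverse stereographic projection of the scaled plane; all
  derivatives of the director are polynomials in it and the coordinates.\<close>

definition stereo_factor :: "real \<Rightarrow> real^3 \<Rightarrow> real"
  where "stereo_factor a x = inverse (1 + a\<^sup>2 * (x$1 * x$1 + x$2 * x$2))"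

text \<open>The projection is from the north pole \<open>e_z\<close>: the axis goes to the south pole.\<close>

definition inv_stereo :: "real \<Rightarrow> real^3 \<Rightarrow> real^3"
  where "inv_stereo a x = vector
    [2 * a * (x$1 * stereo_factor a x), 2 * a * (x$2 * stereo_factor a x), 1 - 2 * stereo_factor a x]"

text \<open>With \<open>u = cos \<Psi>\<close> and \<open>v = sin \<Psi>\<close> the angle equation reads \<open>\<rho> u' = - u v\<close>,
  \<open>\<rho> v' = u\<^sup>2\<close>. The quotient \<open>u / ((1 - v) \<rho>)\<close>, the stereographic coordinate divided by the
  radius, is constant wherever it is defined; together with \<open>u\<^sup>2 + v\<^sup>2 = 1\<close> its value \<open>a\<close>
  determines \<open>u\<close> and \<open>v\<close>. It is defined as long as \<open>u \<noteq> 0\<close>, and this spreads from one radius to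
  all of \<open>(0, 1]\<close>: since \<open>|v| \<le> 1\<close>, the function \<open>u\<^sup>2 \<rho>\<^sup>2\<close> is nondecreasing, which
  handles larger radii, and \<open>u\<^sup>2 / \<rho>\<^sup>2\<close> is nonincreasing, which handles smaller ones.\<close>

lemma escape_angle_explicit:
  assumes esc: "escape_angle \<Psi>" and \<rho>0: "\<rho>0 \<in> {0..1}" "cos (\<Psi> \<rho>0) \<noteq> 0"
  obtains a where "a \<noteq> 0" "\<And>\<rho>. \<rho> \<in> {0<..1} \<Longrightarrow>
    cos (\<Psi> \<rho>) = 2 * a * \<rho> / (1 + a\<^sup>2 * \<rho>\<^sup>2) \<and> sin (\<Psi> \<rho>) = 1 - 2 / (1 + a\<^sup>2 * \<rho>\<^sup>2)"
proof -
  from esc obtain D where D: "(\<Psi> has_real_derivative D \<rho>) (at \<rho> within {0..1})"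
    "\<rho> * D \<rho> = cos (\<Psi> \<rho>)" if "\<rho> \<in> {0..1}" for \<rho>
    unfolding escape_angle_def by metis
  define u where "u \<rho> = cos (\<Psi> \<rho>)" for \<rho>
  define v where "v \<rho> = sin (\<Psi> \<rho>)" for \<rho>
  have uv: "(u \<rho>)\<^sup>2 + (v \<rho>)\<^sup>2 = 1" for \<rho> by (simp add: u_def v_def)
  have du: "(u has_real_derivative - v \<rho> * D \<rho>) (at \<rho> within {0..1})"
    and dv: "(v has_real_derivative u \<rho> * D \<rho>) (at \<rho> within {0..1})" if "\<rho> \<in> {0..1}" for \<rho>
    unfolding u_def v_def by (auto intro!: derivative_eq_intros D(1)[OF that])
  have cont: "continuous_on {0..1} u"
    using du DERIV_continuous continuous_on_eq_continuous_within by blast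
  have \<rho>0pos: "\<rho>0 > 0"
    using D(2)[OF \<rho>0(1)] \<rho>0 by (cases "\<rho>0 = 0") auto
  have du_at: "(u has_real_derivative - v \<rho> * D \<rho>) (at \<rho>)" if "0 < \<rho>" "\<rho> < 1" for \<rho>
    using du[of \<rho>] that at_within_Icc_at[of 0 \<rho> 1] by simp
  have uD: "r * D r = u r" if "0 < r" "r < 1" for r
    using D(2)[of r] that by (simp add: u_def)
  have v1: "v \<rho> \<le> 1" "-1 \<le> v \<rho>" for \<rho> by (simp_all add: v_def)
  have u_nz: "u \<rho> \<noteq> 0" if \<rho>: "\<rho> \<in> {0<..1}" for \<rho>
  proof (cases "\<rho>0 < \<rho>")
    case True
    have "(u \<rho>0)\<^sup>2 * \<rho>0\<^sup>2 \<le> (u \<rho>)\<^sup>2 * \<rho>\<^sup>2"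
    proof (rule DERIV_nonneg_imp_increasing_open[of \<rho>0 \<rho> "\<lambda>r. (u r)\<^sup>2 * r\<^sup>2"])
      fix r assume r: "\<rho>0 < r" "r < \<rho>"
      then have r': "0 < r" "r < 1" using \<rho> \<rho>0pos by auto
      have "((\<lambda>r. (u r)\<^sup>2 * r\<^sup>2) has_real_derivative
          2 * u r * (- v r * D r) * r\<^sup>2 + (u r)\<^sup>2 * (2 * r)) (at r)"
        by (auto intro!: derivative_eq_intros du_at[OF r'])
      moreover have "2 * u r * (- v r * D r) * r\<^sup>2 + (u r)\<^sup>2 * (2 * r) = 2 * r * (u r)\<^sup>2 * (1 - v r)"
        by (simp add: uD[OF r', symmetric] power2_eq_square algebra_simps)
      ultimately show "\<exists>y. ((\<lambda>r. (u r)\<^sup>2 * r\<^sup>2) has_real_derivative y) (at r) \<and> 0 \<le> y"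
        using v1[of r] r' by (metis diff_ge_0_iff_ge less_imp_le mult_nonneg_nonneg zero_le_numeral
            zero_le_power2)
    next
      show "continuous_on {\<rho>0..\<rho>} (\<lambda>r. (u r)\<^sup>2 * r\<^sup>2)"
        by (intro continuous_intros continuous_on_subset[OF cont]) (use \<rho> \<rho>0pos in auto)
    qed (use True in auto)
    moreover have "(u \<rho>0)\<^sup>2 * \<rho>0\<^sup>2 > 0" using \<rho>0(2) \<rho>0pos by (simp add: u_def)
    ultimately show ?thesis by auto
  next
    case False
    have "- ((u \<rho>)\<^sup>2 / \<rho>\<^sup>2) \<le> - ((u \<rho>0)\<^sup>2 / \<rho>0\<^sup>2)"
    proof (rule DERIV_nonneg_imp_increasing_open[of \<rho> \<rho>0 "\<lambda>r. - ((u r)\<^sup>2 / r\<^sup>2)"])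
      fix r assume r: "\<rho> < r" "r < \<rho>0"
      then have r': "0 < r" "r < 1" using \<rho> \<rho>0 by auto
      have "((\<lambda>r. - ((u r)\<^sup>2 / r\<^sup>2)) has_real_derivative
          - ((2 * u r * (- v r * D r) * r\<^sup>2 - (u r)\<^sup>2 * (2 * r)) / (r\<^sup>2 * r\<^sup>2))) (at r)"
        using r' by (auto intro!: derivative_eq_intros du_at[OF r'])
      moreover have "- (2 * u r * (- v r * D r) * r\<^sup>2 - (u r)\<^sup>2 * (2 * r)) = 2 * r * (u r)\<^sup>2 * (1 + v r)"
        by (simp add: uD[OF r', symmetric] power2_eq_square algebra_simps)
      then have "- ((2 * u r * (- v r * D r) * r\<^sup>2 - (u r)\<^sup>2 * (2 * r)) / (r\<^sup>2 * r\<^sup>2))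
          = 2 * r * (u r)\<^sup>2 * (1 + v r) / (r\<^sup>2 * r\<^sup>2)" by (metis minus_divide_left)
      moreover have "0 \<le> 2 * r * (u r)\<^sup>2 * (1 + v r) / (r\<^sup>2 * r\<^sup>2)"
        using v1(2)[of r] r' by (intro divide_nonneg_nonneg mult_nonneg_nonneg) auto
      ultimately show "\<exists>y. ((\<lambda>r. - ((u r)\<^sup>2 / r\<^sup>2)) has_real_derivative y) (at r) \<and> 0 \<le> y"
        by metis
    next
      show "continuous_on {\<rho>..\<rho>0} (\<lambda>r. - ((u r)\<^sup>2 / r\<^sup>2))"
        by (intro continuous_intros continuous_on_subset[OF cont]) (use \<rho> \<rho>0 in auto)
    qed (use False in auto)
    moreover have "(u \<rho>0)\<^sup>2 / \<rho>0\<^sup>2 > 0" using \<rho>0(2) \<rho>0pos by (simp add: u_def)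
    ultimately show ?thesis by auto
  qed
  have v_ne: "1 - v \<rho> \<noteq> 0" if "\<rho> \<in> {0<..1}" for \<rho>
    using uv[of \<rho>] u_nz[OF that] by auto
  have "((\<lambda>r. u r / ((1 - v r) * r)) has_real_derivative 0) (at \<rho> within {0<..1})"
    if \<rho>: "\<rho> \<in> {0<..1}" for \<rho>
  proof -
    have \<rho>': "\<rho> \<in> {0..1}" using \<rho> by auto
    have sub: "{0<..1} \<subseteq> {0..1::real}" by auto
    have "((\<lambda>r. u r / ((1 - v r) * r)) has_real_derivative
       ((- v \<rho> * D \<rho>) * ((1 - v \<rho>) * \<rho>) - u \<rho> * (- (u \<rho> * D \<rho>) * \<rho> + (1 - v \<rho>)))
         / (((1 - v \<rho>) * \<rho>) * ((1 - v \<rho>) * \<rho>))) (at \<rho> within {0<..1})"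
    proof (rule DERIV_divide[OF DERIV_subset[OF du[OF \<rho>'] sub]])
      show "((\<lambda>r. (1 - v r) * r) has_real_derivative - (u \<rho> * D \<rho>) * \<rho> + (1 - v \<rho>))
          (at \<rho> within {0<..1})"
        by (auto intro!: derivative_eq_intros DERIV_subset[OF dv[OF \<rho>'] sub])
    qed (use v_ne[OF \<rho>] \<rho> in auto)
    moreover have "(- v \<rho> * D \<rho>) * ((1 - v \<rho>) * \<rho>) - u \<rho> * (- (u \<rho> * D \<rho>) * \<rho> + (1 - v \<rho>)) = 0"
    proof -
      have "(- v \<rho> * D \<rho>) * ((1 - v \<rho>) * \<rho>) - u \<rho> * (- (u \<rho> * D \<rho>) * \<rho> + (1 - v \<rho>))
        = (\<rho> * D \<rho>) * (u \<rho> * u \<rho> - v \<rho> * (1 - v \<rho>)) - u \<rho> * (1 - v \<rho>)"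
        by (simp add: algebra_simps)
      also have "\<dots> = u \<rho> * ((u \<rho>)\<^sup>2 + (v \<rho>)\<^sup>2 - 1)"
        unfolding D(2)[OF \<rho>'] u_def[symmetric] by (simp add: algebra_simps power2_eq_square)
      finally show ?thesis by (simp add: uv)
    qed
    ultimately show ?thesis by simp
  qed
  then obtain a where a: "\<And>\<rho>. \<rho> \<in> {0<..1} \<Longrightarrow> u \<rho> / ((1 - v \<rho>) * \<rho>) = a"
    using has_field_derivative_zero_constant[of "{0<..1}" "\<lambda>r. u r / ((1 - v r) * r)"]
    by (auto simp: convex_real_interval)
  show thesis
  proof
    show "a \<noteq> 0" using a[of 1] u_nz[of 1] v_ne[of 1] by auto
    fix \<rho> :: real assume \<rho>: "\<rho> \<in> {0<..1}"
    have pos: "1 + a\<^sup>2 * \<rho>\<^sup>2 > 0" by (simp add: add_pos_nonneg)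
    have u: "u \<rho> = a * \<rho> * (1 - v \<rho>)"
      using a[OF \<rho>] v_ne[OF \<rho>] \<rho> by (auto simp: field_simps)
    have "(1 - v \<rho>) * (1 + v \<rho>) = (1 - v \<rho>) * (a\<^sup>2 * \<rho>\<^sup>2 * (1 - v \<rho>))"
      using uv[of \<rho>] unfolding u by algebra
    then have "1 + v \<rho> = a\<^sup>2 * \<rho>\<^sup>2 * (1 - v \<rho>)" using v_ne[OF \<rho>] by simp
    then have v: "v \<rho> = 1 - 2 / (1 + a\<^sup>2 * \<rho>\<^sup>2)" using pos by (simp add: field_simps)
    then have "u \<rho> = 2 * a * \<rho> / (1 + a\<^sup>2 * \<rho>\<^sup>2)" using u by simp
    with v show "cos (\<Psi> \<rho>) = 2 * a * \<rho> / (1 + a\<^sup>2 * \<rho>\<^sup>2) \<and> sin (\<Psi> \<rho>) = 1 - 2 / (1 + a\<^sup>2 * \<rho>\<^sup>2)"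
      by (simp add: u_def v_def)
  qed
qed

lemma stereo_factor_pos: "stereo_factor a x > 0"
  by (simp add: stereo_factor_def add_pos_nonneg)

text \<open>The relation that eliminates the radius: it makes the harmonic map equation and the formula for
  the energy density below polynomial identities.\<close>

lemma stereo_factor_eq: "a\<^sup>2 * (x$1 * x$1 + x$2 * x$2) * stereo_factor a x = 1 - stereo_factor a x"
proof -
  have "1 + a\<^sup>2 * (x$1 * x$1 + x$2 * x$2) > 0" by (simp add: add_pos_nonneg)
  then show ?thesis unfolding stereo_factor_def by (simp add: field_simps)
qed

lemma inv_stereo_nth [simp]:
  "inv_stereo a x $ 1 = 2 * a * (x$1 * stereo_factor a x)"
  "inv_stereo a x $ 2 = 2 * a * (x$2 * stereo_factor a x)"
  "inv_stereo a x $ 3 = 1 - 2 * stereo_factor a x"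
  by (simp_all add: inv_stereo_def)

lemma inv_stereo_unit: "(\<Sum>i\<in>UNIV. (inv_stereo a x $ i)\<^sup>2) = 1"
  using stereo_factor_eq[of a x] unfolding sum_3 inv_stereo_nth by algebra

lemma differentiable_nth: "(\<lambda>y::real^3. y $ i) differentiable (at x)"
  by (intro bounded_linear_imp_differentiable bounded_linear_vec_nth)

lemma stereo_factor_differentiable: "stereo_factor a differentiable (at x)"
proof -
  have "1 + a\<^sup>2 * (x$1 * x$1 + x$2 * x$2) > 0" by (simp add: add_pos_nonneg)
  then show ?thesis
    unfolding stereo_factor_def [abs_def]
    by (intro differentiable_inverse differentiable_add differentiable_mult differentiable_const
        differentiable_nth) auto
qed

lemma partial_stereo_factor:
  "partial k (stereo_factor a) = (\<lambda>x. - 2 * a\<^sup>2 * (if k = 3 then 0 else x $ k) *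
     (stereo_factor a x * stereo_factor a x))"
proof
  fix x :: "real^3"
  have pos: "1 + a\<^sup>2 * (x$1 * x$1 + x$2 * x$2) > 0" by (simp add: add_pos_nonneg)
  have k: "k = 1 \<or> k = 2 \<or> k = 3" using exhaust_3 by auto
  show "partial k (stereo_factor a) x = - 2 * a\<^sup>2 * (if k = 3 then 0 else x $ k) *
     (stereo_factor a x * stereo_factor a x)"
    unfolding stereo_factor_def [abs_def] using pos k
    by (subst partial_inverse)
       (auto simp: partial_add partial_mult partial_component_id differentiable_nth power2_eq_square)
qed

lemma twice_diff_on_stereo_factor: "twice_diff_on U (stereo_factor a)"
  unfolding twice_diff_on_def partial_stereo_factor
proof (intro conjI allI ballI stereo_factor_differentiable)
  fix k x
  show "(\<lambda>x. - 2 * a\<^sup>2 * (if k = 3 then 0 else x $ k) * (stereo_factor a x * stereo_factor a x))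
      differentiable (at x)"
    by (cases "k = 3")
       (simp_all only: refl if_True if_False, (intro differentiable_mult differentiable_const differentiable_nth
        stereo_factor_differentiable)+)
qed

lemma laplacian_stereo_factor:
  "laplacian (stereo_factor a) x = 4 * a\<^sup>2 * (stereo_factor a x)\<^sup>2 - 8 * a\<^sup>2 * (stereo_factor a x)^3"
proof -
  define g where "g = stereo_factor a x"
  have "laplacian (stereo_factor a) x =
     - 4 * a\<^sup>2 * g\<^sup>2 + 8 * (a\<^sup>2 * (x$1 * x$1 + x$2 * x$2) * g) * a\<^sup>2 * g\<^sup>2"
    unfolding laplacian_def partial_stereo_factor sum_3
    by (simp add: partial_mult partial_component_id differentiable_nth stereo_factor_differentiable
        differentiable_mult partial_minus partial_stereo_factor g_def[symmetric])
       algebra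
  also have "\<dots> = 4 * a\<^sup>2 * g\<^sup>2 - 8 * a\<^sup>2 * g^3"
    unfolding stereo_factor_eq[folded g_def] g_def by algebra
  finally show ?thesis by (simp add: g_def)
qed

lemma twice_diff_on_inv_stereo:
  assumes "open U" shows "twice_diff_on U (inv_stereo a)"
proof (rule twice_diff_on_vecI[OF assms])
  fix i :: 3
  have "i = 1 \<or> i = 2 \<or> i = 3" using exhaust_3 by auto
  then show "twice_diff_on U (\<lambda>y. inv_stereo a y $ i)"
    by (auto intro!: twice_diff_on_mult(1) twice_diff_on_diff(1) twice_diff_on_const assms
       twice_diff_on_component_id twice_diff_on_stereo_factor)
qed

lemma partial_inv_stereo:
  "partial k (\<lambda>y. inv_stereo a y $ 3) x
    = 4 * a\<^sup>2 * (if k = 3 then 0 else x $ k) * (stereo_factor a x)\<^sup>2"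
  "i = 1 \<or> i = 2 \<Longrightarrow> partial k (\<lambda>y. inv_stereo a y $ i) x
    = 2 * a * ((if i = k then stereo_factor a x else 0)
        - 2 * a\<^sup>2 * x $ i * (if k = 3 then 0 else x $ k) * (stereo_factor a x)\<^sup>2)"
  by (auto simp: partial_diff partial_mult partial_component_id differentiable_nth partial_stereo_factor
      stereo_factor_differentiable differentiable_mult power2_eq_square algebra_simps)

lemma grad_norm_sq_inv_stereo:
  "grad_norm_sq (inv_stereo a) x = 8 * a\<^sup>2 * (stereo_factor a x)\<^sup>2"
proof -
  define g where "g = stereo_factor a x"
  define R where "R = a\<^sup>2 * (x$1 * x$1 + x$2 * x$2) * g"
  have "grad_norm_sq (inv_stereo a) x = 4 * a\<^sup>2 * g\<^sup>2 * (2 - 4 * R * (1 - R - g))"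
    unfolding grad_norm_sq_def sum_3 R_def
    by (simp add: partial_inv_stereo g_def[symmetric] del: inv_stereo_nth)
       (simp add: algebra_simps power2_eq_square)
  also have "1 - R - g = 0" unfolding R_def g_def stereo_factor_eq by simp
  finally show ?thesis by (simp add: g_def)
qed

text \<open>With \<open>grad_norm_sq_inv_stereo\<close>: the inverse stereographic projection is a harmonic map.\<close>

lemma laplacian_inv_stereo:
  "laplacian (inv_stereo a) x = - (8 * a\<^sup>2 * (stereo_factor a x)\<^sup>2) *\<^sub>R inv_stereo a x"
proof -
  note g = twice_diff_on_stereo_factor[of UNIV a]
  note y = twice_diff_on_component_id[of UNIV]
  note c = twice_diff_on_const[of UNIV]
  have 3: "laplacian (\<lambda>y. inv_stereo a y $ 3) x = -2 * laplacian (stereo_factor a) x"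
    by (simp add: twice_diff_on_diff(2)[OF open_UNIV c twice_diff_on_mult(1)[OF open_UNIV c g]]
        twice_diff_on_mult(2)[OF open_UNIV c g])
  have 12: "laplacian (\<lambda>y. 2 * a * (y $ i * stereo_factor a y)) x =
      - (8 * a\<^sup>2 * (stereo_factor a x)\<^sup>2) * (2 * a * (x $ i * stereo_factor a x))"
    if "i \<noteq> 3" for i
  proof -
    have *: "laplacian (\<lambda>y. y $ i) x = 0"
      by (simp add: laplacian_def partial_component_id)
    have "laplacian (\<lambda>y. 2 * a * (y $ i * stereo_factor a y)) x =
      2 * a * (2 * partial i (stereo_factor a) x + x $ i * laplacian (stereo_factor a) x)"
      by (simp add: twice_diff_on_mult(2)[OF open_UNIV c twice_diff_on_mult(1)[OF open_UNIV y g]]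
        twice_diff_on_mult(2)[OF open_UNIV y g] * partial_component_id if_distrib[of "\<lambda>r. r * _"]
        cong: if_cong)
    then show ?thesis
      unfolding laplacian_stereo_factor partial_stereo_factor using that
      by (simp add: algebra_simps power2_eq_square power3_eq_cube)
  qed
  have "laplacian (\<lambda>y. inv_stereo a y $ i) x
      = - (8 * a\<^sup>2 * (stereo_factor a x)\<^sup>2) * inv_stereo a x $ i" for i
  proof -
    have "i = 1 \<or> i = 2 \<or> i = 3" using exhaust_3 by auto
    then show ?thesis
    proof (elim disjE)
      assume "i = 3" then show ?thesis
        using 3 by (simp add: laplacian_stereo_factor algebra_simps power2_eq_square power3_eq_cube)
    next
      assume i: "i = 1"
      show ?thesis unfolding i inv_stereo_nth by (rule 12) simp
    next
      assume i: "i = 2"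
      show ?thesis unfolding i inv_stereo_nth by (rule 12) simp
    qed
  qed
  then show ?thesis
    by (simp add: vec_eq_iff twice_diff_on_vec_nth(2)[OF open_UNIV twice_diff_on_inv_stereo[OF open_UNIV]]
        del: inv_stereo_nth)
qed

section \<open>Rigidity of the order parameter\<close>

text \<open>The axis is removed because there the angle is undetermined and the first integral above gives
  no information.\<close>

definition punctured_cylinder :: "(real^3) set"
  where "punctured_cylinder = {x. 0 < x$1 * x$1 + x$2 * x$2 \<and> x$1 * x$1 + x$2 * x$2 < 1}"

lemma open_punctured_cylinder: "open punctured_cylinder"
  unfolding punctured_cylinder_def
  by (intro open_Collect_conj open_Collect_less continuous_intros)

lemma cyl_coords_nth [simp]:
  "cyl_coords \<rho> \<theta> z $ 1 = \<rho> * cos \<theta>" "cyl_coords \<rho> \<theta> z $ 2 = \<rho> * sin \<theta>"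
  "cyl_coords \<rho> \<theta> z $ 3 = z"
  by (simp_all add: cyl_coords_def)

lemma cyl_coords_radius: "((\<rho>::real) * cos \<theta>) * (\<rho> * cos \<theta>) + (\<rho> * sin \<theta>) * (\<rho> * sin \<theta>) = \<rho>\<^sup>2"
  using sin_cos_squared_add3[of \<theta>] by algebra

lemma cyl_coords_in_punctured:
  assumes "0 < \<rho>" "\<rho> < 1" shows "cyl_coords \<rho> \<theta> z \<in> punctured_cylinder"
  using assms cyl_coords_radius[of \<rho> \<theta>] by (simp add: punctured_cylinder_def power_less_one_iff)

lemma punctured_cylinder_polar:
  assumes "x \<in> punctured_cylinder"
  obtains \<rho> \<theta> z where "0 < \<rho>" "\<rho> < 1" "x = cyl_coords \<rho> \<theta> z"
proof -
  define \<rho> where "\<rho> = sqrt (x$1 * x$1 + x$2 * x$2)"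
  have \<rho>: "0 < \<rho>" "\<rho> < 1" "\<rho>\<^sup>2 = x$1 * x$1 + x$2 * x$2"
    using assms by (auto simp: punctured_cylinder_def \<rho>_def)
  have "(x$1 / \<rho>)\<^sup>2 + (x$2 / \<rho>)\<^sup>2 = (x$1 * x$1 + x$2 * x$2) / \<rho>\<^sup>2"
    by (simp add: add_divide_distrib power2_eq_square)
  also have "\<dots> = 1" unfolding \<rho>(3)[symmetric] using \<rho>(1) by simp
  finally have "(x$1 / \<rho>)\<^sup>2 + (x$2 / \<rho>)\<^sup>2 = 1" .
  then obtain \<theta> where "x$1 / \<rho> = cos \<theta>" "x$2 / \<rho> = sin \<theta>"
    using sincos_total_2pi by metis
  then have "x = cyl_coords \<rho> \<theta> (x$3)"
    using \<rho>(1) by (simp add: vec_eq_iff forall_3 field_simps)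
  with \<rho> that show thesis by blast
qed

lemma punctured_cylinder_subset: "punctured_cylinder \<subseteq> interior cylinder"
proof (rule interior_maximal[OF _ open_punctured_cylinder], rule subsetI)
  fix x assume "x \<in> punctured_cylinder"
  then obtain \<rho> \<theta> z where "0 < \<rho>" "\<rho> < 1" "x = cyl_coords \<rho> \<theta> z"
    by (rule punctured_cylinder_polar)
  then show "x \<in> cylinder" unfolding cylinder_def by force
qed

text \<open>The axis and the lateral boundary are the two end points of horizontal rays whose open part lies
  in the punctured cylinder, so one limit along a ray reaches both.\<close>

lemma vanishes_on_cylinder:
  fixes f :: "real^3 \<Rightarrow> 'a::real_normed_vector"
  assumes "continuous_on cylinder f" "\<And>x. x \<in> punctured_cylinder \<Longrightarrow> f x = 0" "x \<in> cylinder"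
  shows "f x = 0"
proof -
  obtain \<rho> \<theta> z where x: "x = cyl_coords \<rho> \<theta> z" "0 \<le> \<rho>" "\<rho> \<le> 1"
    using assms(3) by (auto simp: cylinder_def)
  have "continuous_on {0..1} (\<lambda>r. cyl_coords r \<theta> z)"
  proof -
    have "(\<lambda>r. cyl_coords r \<theta> z) = (\<lambda>r. r *\<^sub>R e_r \<theta> + z *\<^sub>R e_z)"
      by (rule ext) (simp add: vec_eq_iff forall_3 e_r_def e_z_def)
    then show ?thesis by (simp only:) (intro continuous_intros)
  qed
  moreover have "(\<lambda>r. cyl_coords r \<theta> z) ` {0..1} \<subseteq> cylinder"
    unfolding cylinder_def by fastforce
  ultimately have "continuous_on {0..1} (\<lambda>r. f (cyl_coords r \<theta> z))"
    using continuous_on_compose2[OF assms(1)] by blast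
  then have "continuous_on (closure {0<..<1::real}) (\<lambda>r. f (cyl_coords r \<theta> z))" by simp
  then have "f (cyl_coords \<rho> \<theta> z) = 0"
    by (rule continuous_constant_on_closure[where a = 0])
       (use x assms(2) cyl_coords_in_punctured in auto)
  with x show ?thesis by simp
qed

lemma cyl_coords_vertical_derivative:
  assumes "f differentiable (at (cyl_coords \<rho> \<theta> z))"
  shows "((\<lambda>z. f (cyl_coords \<rho> \<theta> z)) has_real_derivative partial 3 f (cyl_coords \<rho> \<theta> z)) (at z)"
proof -
  have eq: "(\<lambda>z. cyl_coords \<rho> \<theta> z) = (\<lambda>z. \<rho> *\<^sub>R e_r \<theta> + z *\<^sub>R axis 3 1)"
    by (rule ext) (simp add: vec_eq_iff forall_3 e_r_def axis_def)
  have "((\<lambda>z. cyl_coords \<rho> \<theta> z) has_vector_derivative axis 3 1) (at z)"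
    unfolding eq by (auto intro!: derivative_eq_intros)
  from vector_derivative_diff_chain_within[OF this, of f "frechet_derivative f (at (cyl_coords \<rho> \<theta> z))"]
  show ?thesis
    using assms by (simp add: o_def partial_def frechet_derivative_works has_real_derivative_iff_has_vector_derivative
       has_derivative_at_withinI)
qed

text \<open>The vertical dependence of \<open>s\<close> is arbitrary, so no ordinary differential equation is solved: the
  same value \<open>\<partial>\<^sub>3\<partial>\<^sub>3 s\<close> occurs in the scalar equation at two radii, and subtraction leaves
  \<open>s\<close> times the difference of the two energy densities.\<close>

lemma vanishing_of_inv_stereo_system:
  assumes a: "a \<noteq> 0" and s: "twice_diff_on punctured_cylinder s"
    and sys: "\<And>x::real^3. x \<in> punctured_cylinder \<Longrightarrow> uniaxial_system t s (inv_stereo a) x"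
    and x: "x \<in> punctured_cylinder"
  shows "s x = 0"
proof -
  let ?U = punctured_cylinder
  let ?N = "inv_stereo a"
  note N = twice_diff_on_inv_stereo[OF open_punctured_cylinder, of a]
  have hor: "partial 1 s y = 0" "partial 2 s y = 0" if y: "y \<in> ?U" for y
  proof -
    define g where "g = stereo_factor a y"
    have g: "g > 0" by (simp add: g_def stereo_factor_pos)
    have "(\<Sum>k\<in>UNIV. partial k s y *\<^sub>R partial k ?N y) = 0"
      using sys[OF y] unfolding uniaxial_system_def grad_norm_sq_inv_stereo laplacian_inv_stereo
      by simp
    then have "(\<Sum>k\<in>UNIV. partial k s y * partial k (\<lambda>z. ?N z $ i) y) = 0" for i
      unfolding partial_vec_nth[OF twice_diff_onD(1)[OF N y]]
      by (metis (mono_tags, lifting) sum.cong sum_component vector_scaleR_component real_scaleR_def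
          zero_index)
    from this[of 1] this[of 2] this[of 3]
    have "partial 1 s y * (2 * a * (g - 2 * a\<^sup>2 * y$1 * y$1 * g\<^sup>2))
        + partial 2 s y * (2 * a * (- 2 * a\<^sup>2 * y$1 * y$2 * g\<^sup>2)) = 0"
      "partial 1 s y * (2 * a * (- 2 * a\<^sup>2 * y$2 * y$1 * g\<^sup>2))
        + partial 2 s y * (2 * a * (g - 2 * a\<^sup>2 * y$2 * y$2 * g\<^sup>2)) = 0"
      "partial 1 s y * (4 * a\<^sup>2 * y$1 * g\<^sup>2) + partial 2 s y * (4 * a\<^sup>2 * y$2 * g\<^sup>2) = 0"
      unfolding sum_3 by (simp_all add: partial_inv_stereo g_def del: inv_stereo_nth)
    \<comment> \<open>The third equation says that the radial derivative vanishes, which cancels the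
      quadratic terms of the first two.\<close>
    then have "2 * a * g * partial 1 s y = 0" "2 * a * g * partial 2 s y = 0"
      by algebra+
    then show "partial 1 s y = 0" "partial 2 s y = 0" using a g by auto
  qed
  have lap: "laplacian s y = partial 3 (partial 3 s) y" if y: "y \<in> ?U" for y
    using partial_cong_open[OF open_punctured_cylinder hor(1) y, where k=1]
      partial_cong_open[OF open_punctured_cylinder hor(2) y, where k=2]
    by (simp add: laplacian_def sum_3)
  obtain \<rho> \<theta> z where \<rho>: "0 < \<rho>" "\<rho> < 1" and xeq: "x = cyl_coords \<rho> \<theta> z"
    using x by (rule punctured_cylinder_polar)
  define h where "h z = s (cyl_coords \<rho> \<theta> z)" for z
  have indep: "s (cyl_coords r \<theta> z) = h z" if r: "0 < r" "r < 1" for r z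
  proof -
    have "((\<lambda>r. s (cyl_coords r \<theta> z)) has_real_derivative 0) (at r within {0<..<1})"
      if r: "r \<in> {0<..<1}" for r
    proof -
      let ?y = "cyl_coords r \<theta> z" and ?D = "frechet_derivative s (at (cyl_coords r \<theta> z))"
      have y: "?y \<in> ?U" using r by (simp add: cyl_coords_in_punctured)
      have D: "(s has_derivative ?D) (at ?y)"
        using twice_diff_onD(1)[OF s y] by (simp add: frechet_derivative_works)
      have e: "e_r \<theta> = cos \<theta> *\<^sub>R axis 1 1 + sin \<theta> *\<^sub>R axis 2 1"
        by (simp add: vec_eq_iff forall_3 e_r_def axis_def)
      have "?D (e_r \<theta>) = cos \<theta> * partial 1 s ?y + sin \<theta> * partial 2 s ?y"
        using has_derivative_linear[OF D] unfolding e partial_def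
        by (simp add: linear_add linear_scale)
      then have 0: "?D (e_r \<theta>) = 0" using hor[OF y] by simp
      have eq: "(\<lambda>r. cyl_coords r \<theta> z) = (\<lambda>r. r *\<^sub>R e_r \<theta> + z *\<^sub>R e_z)"
        by (rule ext) (simp add: vec_eq_iff forall_3 e_r_def e_z_def)
      have "((\<lambda>r. cyl_coords r \<theta> z) has_vector_derivative e_r \<theta>) (at r within {0<..<1})"
        unfolding eq by (auto intro!: derivative_eq_intros)
      from vector_derivative_diff_chain_within[OF this has_derivative_at_withinI[OF D]]
      show ?thesis by (simp add: o_def 0 has_real_derivative_iff_has_vector_derivative)
    qed
    then have "\<exists>c. \<forall>r\<in>{0<..<1}. s (cyl_coords r \<theta> z) = c"
      by (intro has_field_derivative_zero_constant) auto
    then show ?thesis using r \<rho> by (auto simp: h_def)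
  qed
  have d1: "partial 3 s (cyl_coords r \<theta> z) = deriv h z" if r: "0 < r" "r < 1" for r z
    using cyl_coords_vertical_derivative[OF twice_diff_onD(1)[OF s cyl_coords_in_punctured[OF r]], of \<theta> z]
    unfolding indep[OF r] by (simp add: DERIV_imp_deriv)
  have d2: "partial 3 (partial 3 s) (cyl_coords r \<theta> z) = deriv (deriv h) z" if r: "0 < r" "r < 1" for r
    using cyl_coords_vertical_derivative[OF twice_diff_onD(2)[OF s cyl_coords_in_punctured[OF r]], of 3 \<theta> z]
    unfolding d1[OF r] by (simp add: DERIV_imp_deriv)
  define g where "g r = inverse (1 + a\<^sup>2 * r\<^sup>2)" for r :: real
  have eqn: "deriv (deriv h) z = 3 * (8 * a\<^sup>2 * (g r)\<^sup>2) * h z + t * h z - sqrt 6 * (h z)\<^sup>2 + 4/3 * (h z)^3"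
    if r: "0 < r" "r < 1" for r
  proof -
    have y: "cyl_coords r \<theta> z \<in> ?U" using r by (simp add: cyl_coords_in_punctured)
    have "stereo_factor a (cyl_coords r \<theta> z) = g r"
      by (simp add: stereo_factor_def g_def cyl_coords_radius)
    then show ?thesis
      using sys[OF y] unfolding uniaxial_system_def lap[OF y] d2[OF r] indep[OF r] grad_norm_sq_inv_stereo
      by simp
  qed
  have "a\<^sup>2 * (g (1/3))\<^sup>2 * h z = a\<^sup>2 * (g (2/3))\<^sup>2 * h z"
    using eqn[of "1/3"] eqn[of "2/3"] by auto
  moreover have "(g (1/3))\<^sup>2 \<noteq> (g (2/3))\<^sup>2"
  proof -
    have p: "a\<^sup>2 > 0" using a by simp
    then have "g (2/3) < g (1/3)" "0 \<le> g (2/3)"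
      unfolding g_def by (auto intro!: less_imp_inverse_less add_pos_pos simp: power2_eq_square)
    then show ?thesis by (metis less_irrefl power_strict_mono zero_less_numeral)
  qed
  ultimately have "h z = 0" using a by auto
  then show ?thesis by (simp add: xeq h_def)
qed

theorem mainTheorem4:
  fixes t :: real and \<Psi> :: "real \<Rightarrow> real" and n :: "real^3 \<Rightarrow> real^3"
  assumes "t \<le> 1"
    and "escape_angle \<Psi>"
    and "\<exists>\<rho>\<in>{0..1}. cos (\<Psi> \<rho>) \<noteq> 0"
    and "escape_director \<Psi> n"
  shows "(\<nexists>s :: real^3 \<Rightarrow> real.
            classical_on cylinder s \<and> (\<exists>x\<in>cylinder. s x \<noteq> 0) \<and>
            (\<forall>x\<in>interior cylinder. uniaxial_system t s n x)) \<and>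
         (\<nexists>(s :: real^3 \<Rightarrow> real) (Q :: real^3 \<Rightarrow> real^3^3).
            (\<forall>x\<in>cylinder. Q x = uniaxial_tensor (s x) (n x)) \<and>
            (\<exists>x\<in>cylinder. s x \<noteq> 0) \<and>
            classical_on cylinder Q \<and>
            (\<forall>x\<in>interior cylinder. Q_equation t Q x))"
proof -
  let ?U = punctured_cylinder
  note U = open_punctured_cylinder
  obtain a where a: "a \<noteq> 0" and ang: "\<And>\<rho>. \<rho> \<in> {0<..1} \<Longrightarrow>
      cos (\<Psi> \<rho>) = 2 * a * \<rho> / (1 + a\<^sup>2 * \<rho>\<^sup>2) \<and> sin (\<Psi> \<rho>) = 1 - 2 / (1 + a\<^sup>2 * \<rho>\<^sup>2)"
    using assms(2,3) escape_angle_explicit by metis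
  have nN: "n x = inv_stereo a x" if x: "x \<in> ?U" for x
  proof -
    obtain \<rho> \<theta> z where \<rho>: "0 < \<rho>" "\<rho> < 1" and xeq: "x = cyl_coords \<rho> \<theta> z"
      using x by (rule punctured_cylinder_polar)
    have "n x = cos (\<Psi> \<rho>) *\<^sub>R e_r \<theta> + sin (\<Psi> \<rho>) *\<^sub>R e_z"
      using assms(4) \<rho> by (simp add: escape_director_def xeq)
    then show ?thesis
      using ang[of \<rho>] \<rho>
      by (simp add: vec_eq_iff forall_3 xeq e_r_def e_z_def stereo_factor_def cyl_coords_radius
          divide_inverse)
  qed
  have vanish: "s x = 0" if "twice_diff_on ?U s" "\<And>x. x \<in> ?U \<Longrightarrow> uniaxial_system t s n x" "x \<in> ?U" for s x
    using vanishing_of_inv_stereo_system[OF a that(1) _ that(3), of t] that(2)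
      uniaxial_system_cong_open[where n=n and m="inv_stereo a", OF U nN] by blast
  have "s x = 0" if s: "classical_on cylinder s" "\<forall>x\<in>interior cylinder. uniaxial_system t s n x"
    and x: "x \<in> cylinder" for s x
  proof (rule vanishes_on_cylinder[OF _ _ x])
    show "continuous_on cylinder s" using s by (simp add: classical_on_def)
    show "s y = 0" if "y \<in> ?U" for y
      using vanish[OF classical_on_imp_twice_diff_on[OF s(1) punctured_cylinder_subset]] s(2)
        punctured_cylinder_subset that by blast
  qed
  moreover
  have "s x = 0" if Q: "\<forall>x\<in>cylinder. Q x = uniaxial_tensor (s x) (n x)" "classical_on cylinder Q"
    "\<forall>x\<in>interior cylinder. Q_equation t Q x" and x: "x \<in> cylinder"
    for s x and Q :: "real^3 \<Rightarrow> real^3^3"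
  proof -
    have sub: "?U \<subseteq> cylinder" using punctured_cylinder_subset interior_subset by blast
    have tdQ: "twice_diff_on ?U Q"
      by (rule classical_on_imp_twice_diff_on[OF Q(2) punctured_cylinder_subset])
    have tdn: "twice_diff_on ?U n"
      by (rule twice_diff_on_cong[OF U nN[symmetric] twice_diff_on_inv_stereo[OF U]])
    have unit: "(\<Sum>i\<in>UNIV. (n y $ i)\<^sup>2) = 1" if "y \<in> ?U" for y
      using nN[OF that] inv_stereo_unit by simp
    \<comment> \<open>The hypothesis gives regularity of \<open>Q\<close> only; \<open>s\<close> is a polynomial in \<open>n\<close> and \<open>Q\<close>.\<close>
    have tds: "twice_diff_on ?U s"
    proof (rule twice_diff_on_cong[OF U])
      show "twice_diff_on ?U (\<lambda>y. 3/2 * (\<Sum>i\<in>UNIV. \<Sum>j\<in>UNIV. n y $ i * (Q y $ i $ j * n y $ j)))"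
        by (intro twice_diff_on_mult twice_diff_on_const twice_diff_on_sum3 twice_diff_on_vec_nth
            tdQ tdn U)
      show "3/2 * (\<Sum>i\<in>UNIV. \<Sum>j\<in>UNIV. n y $ i * (Q y $ i $ j * n y $ j)) = s y" if "y \<in> ?U" for y
      proof -
        have "Q y = uniaxial_tensor (s y) (n y)" using Q(1) sub that by blast
        then show ?thesis by (simp only: uniaxial_tensor_contract[OF unit[OF that]])
      qed
    qed
    have "uniaxial_system t s n y" if y: "y \<in> ?U" for y
      by (rule uniaxial_system_if_Q_equation[where Q=Q, OF U y tds tdn unit])
         (use Q punctured_cylinder_subset sub y in auto)
    then have s0: "s y = 0" if "y \<in> ?U" for y using vanish[OF tds] that by blast
    \<comment> \<open>The closure argument runs on \<open>Q\<close>, since continuity of \<open>s\<close> on the closed cylinder is not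
      among the hypotheses.\<close>
    have "Q x = 0"
    proof (rule vanishes_on_cylinder[OF _ _ x])
      show "continuous_on cylinder Q" using Q by (simp add: classical_on_def)
      show "Q y = 0" if "y \<in> ?U" for y
        using Q(1) sub that s0[OF that] by (auto simp: uniaxial_tensor_def)
    qed
    moreover have "(\<Sum>i\<in>UNIV. (n x $ i)\<^sup>2) = 1"
    proof -
      obtain \<rho> \<theta> z where "x = cyl_coords \<rho> \<theta> z" "\<rho> \<in> {0..1}"
        using x by (auto simp: cylinder_def)
      then have "n x = cos (\<Psi> \<rho>) *\<^sub>R e_r \<theta> + sin (\<Psi> \<rho>) *\<^sub>R e_z"
        using assms(4) by (simp add: escape_director_def)
      then show ?thesis
        by (simp add: sum_3 e_r_def e_z_def power_mult_distrib distrib_left[symmetric])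
    qed
    ultimately show "s x = 0"
      using uniaxial_tensor_contract[of "n x" "s x"] Q(1) x by simp
  qed
  ultimately show ?thesis by blast
qed

end
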